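(* Let $G$ be a countable group. Then there exist a countable group $\Gamma$ that is (isomorphic to) a subgroup of $\bigoplus_{\mathbb{N}} \mathbb{Z}$ (so $\Gamma$ is a countable free abelian group) and an aperiodic minimal Cantor system $(X,S,\Gamma)$ such that $G$ is isomorphic to a subgroup of $\mathrm{Norm}(S,\Gamma)$.
   Context: A Cantor set is a nonempty compact metrizable totally disconnected space without isolated points. A Cantor system $(X,T,\Gamma)$ is a continuous action $T:\Gamma\times X\to X$ of a countable (discrete) group $\Gamma$ on a Cantor set $X$; write $T^{\gamma}:X\to X$ for the homeomorphism $x\mapsto T(\gamma,x)$. The system is aperiodic if the action is free, i.e. $T^{\gamma}(x)=x$ for some $x\in X$ implies $\gamma=1_\Gamma$. It is minimal if for every $x\in X$ the orbit $\{T^{\gamma}(x):\gamma\in\Gamma\}$ is dense in $X$. For an aperiodic Cantor system $(X,T,\Gamma)$, the normalizer $\mathrm{Norm}(T,\Gamma)$ is the group (under composition) of all homeomorphisms $h:X\to X$ such that $h\langle T\rangle h^{-1}=\langle T\rangle$, where $\langle T\rangle=\{T^{\gamma}:\gamma\in\Gamma\}$; equivalently, there exists a group automorphism $\alpha_h\in\mathrm{Aut}(\Gamma)$ such that $h\circ T^{g}=T^{\alpha_h(g)}\circ h$ for every $g\in\Gamma$. *)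

theory Defs
  imports "HOL-Analysis.Analysis" "HOL-Algebra.Free_Abelian_Groups" "HOL-Algebra.Group_Action"
begin

definition totally_disconnected_space :: "'x topology \<Rightarrow> bool" where
  "totally_disconnected_space X \<longleftrightarrow> (\<forall>C. connectedin X C \<longrightarrow> (\<exists>x. C \<subseteq> {x}))"

definition Cantor_space :: "'x topology \<Rightarrow> bool" where
  "Cantor_space X \<longleftrightarrow>
     topspace X \<noteq> {} \<and> compact_space X \<and> metrizable_space X \<and>
     totally_disconnected_space X \<and> (\<forall>x\<in>topspace X. \<not> openin X {x})"

text \<open>
  The locale \<open>group_action\<close> makes each \<open>T \<gamma>\<close> an element of \<open>BijGroup (topspace X)\<close>, i.e. a
  bijection that is \<open>undefined\<close> off \<open>topspace X\<close>, so that maps agreeing on the space are equal.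
\<close>
locale Cantor_system = group_action \<Gamma> "topspace X" T
  for X :: "'x topology" and T :: "'c \<Rightarrow> 'x \<Rightarrow> 'x" and \<Gamma> :: "('c, 'm) monoid_scheme" +
  assumes Cantor: "Cantor_space X"
    and countable: "countable (carrier \<Gamma>)"
    and continuous:
      "continuous_map (prod_topology (discrete_topology (carrier \<Gamma>)) X) X (\<lambda>(\<gamma>, x). T \<gamma> x)"

definition aperiodic_system ::
    "'x topology \<Rightarrow> ('c \<Rightarrow> 'x \<Rightarrow> 'x) \<Rightarrow> ('c, 'm) monoid_scheme \<Rightarrow> bool" where
  "aperiodic_system X T \<Gamma> \<longleftrightarrow>
     (\<forall>\<gamma>\<in>carrier \<Gamma>. \<forall>x\<in>topspace X. T \<gamma> x = x \<longrightarrow> \<gamma> = \<one>\<^bsub>\<Gamma>\<^esub>)"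

definition minimal_system ::
    "'x topology \<Rightarrow> ('c \<Rightarrow> 'x \<Rightarrow> 'x) \<Rightarrow> ('c, 'm) monoid_scheme \<Rightarrow> bool" where
  "minimal_system X T \<Gamma> \<longleftrightarrow>
     (\<forall>x\<in>topspace X. X closure_of orbit \<Gamma> T x = topspace X)"

definition homeo_group :: "'x topology \<Rightarrow> ('x \<Rightarrow> 'x) monoid" where
  "homeo_group X =
     BijGroup (topspace X) \<lparr>carrier := {h \<in> Bij (topspace X). homeomorphic_map X X h}\<rparr>"

definition Norm ::
    "'x topology \<Rightarrow> ('c \<Rightarrow> 'x \<Rightarrow> 'x) \<Rightarrow> ('c, 'm) monoid_scheme \<Rightarrow> ('x \<Rightarrow> 'x) monoid" where
  "Norm X T \<Gamma> =
     homeo_group X \<lparr>carrier := normalizer (homeo_group X) (T ` carrier \<Gamma>)\<rparr>"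

lemma subgroup_homeo:
  "subgroup {h \<in> Bij (topspace X). homeomorphic_map X X h} (BijGroup (topspace X))"
proof (rule subgroup.intro)
  let ?H = "{h \<in> Bij (topspace X). homeomorphic_map X X h}"
  show "?H \<subseteq> carrier (BijGroup (topspace X))"
    by (auto simp: BijGroup_def)
  show "\<one>\<^bsub>BijGroup (topspace X)\<^esub> \<in> ?H"
    using homeomorphic_map_eq[OF homeomorphic_map_id[THEN iffD2, OF refl],
        where g = "\<lambda>x\<in>topspace X. x"]
    by (auto simp: BijGroup_def id_Bij)
  fix f g assume fg: "f \<in> ?H" "g \<in> ?H"
  have "homeomorphic_map X X (f \<circ> g)"
    using fg homeomorphic_map_compose by blast
  then have "homeomorphic_map X X (compose (topspace X) f g)"
    by (rule homeomorphic_map_eq) (simp add: compose_def)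
  with fg show "f \<otimes>\<^bsub>BijGroup (topspace X)\<^esub> g \<in> ?H"
    by (simp add: BijGroup_def compose_Bij)
next
  let ?H = "{h \<in> Bij (topspace X). homeomorphic_map X X h}"
  fix f assume f: "f \<in> ?H"
  then obtain g where g: "homeomorphic_maps X X f g"
    using homeomorphic_map_maps by blast
  then have gm: "homeomorphic_map X X g"
    using homeomorphic_maps_map homeomorphic_maps_sym by blast
  have "restrict (inv_into (topspace X) f) (topspace X) x = g x" if "x \<in> topspace X" for x
  proof -
    have "f (g x) = x" "g x \<in> topspace X"
      using g that by (auto simp: homeomorphic_maps_def continuous_map_def)
    then show ?thesis
      using f that by (simp add: Bij_def bij_betw_def inv_into_f_eq)
  qed
  then have "homeomorphic_map X X (restrict (inv_into (topspace X) f) (topspace X))"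
    using homeomorphic_map_eq[OF gm] by metis
  with f show "inv\<^bsub>BijGroup (topspace X)\<^esub> f \<in> ?H"
    by (simp add: inv_BijGroup restrict_inv_into_Bij del: restrict_apply)
qed

lemma group_homeo_group: "group (homeo_group X)"
  unfolding homeo_group_def
  by (rule subgroup.subgroup_is_group[OF subgroup_homeo group_BijGroup])

lemma (in Cantor_system) acts_by_homeomorphisms: "T ` carrier \<Gamma> \<subseteq> carrier (homeo_group X)"
proof -
  interpret H: group_hom \<Gamma> "BijGroup (topspace X)" T
    by (rule group_hom)
  have cont: "continuous_map X X (T \<gamma>)" if "\<gamma> \<in> carrier \<Gamma>" for \<gamma>
  proof -
    have "continuous_map X (prod_topology (discrete_topology (carrier \<Gamma>)) X) (\<lambda>x. (\<gamma>, x))"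
      using that by (simp add: continuous_map_pairwise o_def)
    from continuous_map_compose[OF this continuous] show ?thesis
      by (simp add: o_def)
  qed
  have "homeomorphic_map X X (T \<gamma>)" if "\<gamma> \<in> carrier \<Gamma>" for \<gamma>
  proof -
    have inv: "inv\<^bsub>\<Gamma>\<^esub> \<gamma> \<in> carrier \<Gamma>"
      using that by simp
    have "homeomorphic_maps X X (T \<gamma>) (T (inv\<^bsub>\<Gamma>\<^esub> \<gamma>))"
      unfolding homeomorphic_maps_def
    proof (intro conjI ballI)
      show "continuous_map X X (T \<gamma>)" "continuous_map X X (T (inv\<^bsub>\<Gamma>\<^esub> \<gamma>))"
        by (rule cont[OF that], rule cont[OF inv])
      fix x assume x: "x \<in> topspace X"
      show "T (inv\<^bsub>\<Gamma>\<^esub> \<gamma>) (T \<gamma> x) = x"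
        using orbit_sym_aux[OF that x refl] .
      show "T \<gamma> (T (inv\<^bsub>\<Gamma>\<^esub> \<gamma>) x) = x"
        using orbit_sym_aux[OF inv x refl] that by simp
    qed
    then show ?thesis
      using homeomorphic_map_maps by blast
  qed
  then show ?thesis
    using H.hom_closed by (auto simp: homeo_group_def BijGroup_def)
qed

lemma (in Cantor_system) group_Norm: "group (Norm X T \<Gamma>)"
  unfolding Norm_def
  by (intro subgroup.subgroup_is_group group.normalizer_imp_subgroup
      group_homeo_group acts_by_homeomorphisms)

end

theory Submission
  imports Defs "HOL-Number_Theory.Cong"
begin

text \<open>
  Let \<open>C\<close> be the compact group of all families of residues, one modulo each prime. The integers act
  on \<open>C\<close> by adding the same integer to every residue. An integer fixing a point is divisible by
  every prime, so it is \<open>0\<close>; and by the Chinese remainder theorem an orbit meets every prescription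
  of finitely many residues, so it is dense.
  
  Take countably many copies of this system: \<open>\<Gamma> = \<Oplus>\<^sub>\<nat> \<int>\<close> acts on \<open>X = C\<^sup>\<nat>\<close>, the \<open>i\<close>-th integer acting on
  the \<open>i\<close>-th copy. Freeness is inherited copy by copy (\<open>rotation_free\<close>). So is density, since a basic
  open set constrains only finitely many copies (\<open>rotation_approximates\<close>). As a countable product of
  finite discrete spaces, \<open>X\<close> is compact, metrizable and totally disconnected, and it has no isolated
  point: a neighbourhood leaves some copy free, where one may rotate.
  
  The gain from taking many copies is symmetry. Any permutation of \<open>\<nat>\<close> permutes the copies by a
  homeomorphism of \<open>X\<close>, and conjugating by it turns addition of \<open>\<gamma>\<close> into addition of the permuted
  sequence, which again belongs to \<open>\<Gamma>\<close>. So all of \<open>Sym(\<nat>)\<close> embeds in the normalizer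
  (\<open>permute_blocks_hom\<close>, \<open>permute_blocks_inj\<close>). By Cayley's theorem \<open>Sym(\<nat>)\<close> contains every countable
  group (\<open>countable_group_embeds_in_permutations\<close>), so one and the same system works for all \<open>G\<close>.
\<close>

section \<open>Residues modulo the primes\<close>

text \<open>
  The value \<open>1\<close> off the primes makes the residue trivial there, so that the moduli can be indexed by
  all natural numbers and stay pairwise coprime.
\<close>

definition modulus :: "nat \<Rightarrow> int" where
  "modulus n = (if prime n then int n else 1)"

text \<open>
  A point of the space is a family of residues indexed by pairs (copy, modulus). The pair is coded as a
  single natural number, of which \<open>block\<close> is the copy and \<open>level\<close> the index of the modulus.
\<close>

definition block :: "nat \<Rightarrow> nat" where
  "block k = fst (prod_decode k)"

definition level :: "nat \<Rightarrow> nat" where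
  "level k = snd (prod_decode k)"

definition residue_space :: "(nat \<Rightarrow> int) topology" where
  "residue_space = product_topology (\<lambda>k. discrete_topology {0..<modulus (level k)}) UNIV"

abbreviation integer_sum :: "(nat \<Rightarrow> int) monoid" where
  "integer_sum \<equiv> sum_group UNIV (\<lambda>_. integer_group)"

definition rotation :: "(nat \<Rightarrow> int) \<Rightarrow> (nat \<Rightarrow> int) \<Rightarrow> nat \<Rightarrow> int" where
  "rotation \<gamma> = (\<lambda>x\<in>topspace residue_space. \<lambda>k. (x k + \<gamma> (block k)) mod modulus (level k))"

definition relabel :: "(nat \<Rightarrow> nat) \<Rightarrow> nat \<Rightarrow> nat" where
  "relabel p k = prod_encode (p (block k), level k)"

text \<open>
  The inverse makes this a left action: copy \<open>i\<close> of the argument becomes copy \<open>p i\<close> of the result.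
\<close>

definition permute_blocks :: "(nat \<Rightarrow> nat) \<Rightarrow> (nat \<Rightarrow> int) \<Rightarrow> nat \<Rightarrow> int" where
  "permute_blocks p = (\<lambda>x\<in>topspace residue_space. \<lambda>k. x (relabel (inv_into UNIV p) k))"

lemma block_encode [simp]: "block (prod_encode (i, n)) = i"
  and level_encode [simp]: "level (prod_encode (i, n)) = n"
  and encode_block_level [simp]: "prod_encode (block k, level k) = k"
  by (simp_all add: block_def level_def)

lemma block_relabel [simp]: "block (relabel p k) = p (block k)"
  and level_relabel [simp]: "level (relabel p k) = level k"
  and relabel_comp: "relabel p (relabel q k) = relabel (p \<circ> q) k"
  and relabel_id [simp]: "relabel id k = k" 
  by (simp_all add: relabel_def)

lemma modulus_pos [simp]: "0 < modulus n"
  by (simp add: modulus_def prime_gt_0_nat)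

lemma modulus_nonneg [simp]: "0 \<le> modulus n"
  by (rule less_imp_le) simp

text \<open>
  A nonzero integer has a prime larger than its absolute value, and that prime cannot divide it.
\<close>

lemma eq_0_if_all_primes_dvd:
  assumes "\<And>n. modulus n dvd a"
  shows "a = 0"
proof (rule ccontr)
  assume "a \<noteq> 0"
  obtain p where p: "prime p" "nat \<bar>a\<bar> < p"
    using bigger_prime by blast
  then have "int p dvd a"
    using assms[of p] by (simp add: modulus_def)
  then have "int p \<le> \<bar>a\<bar>"
    using dvd_imp_le_int[OF \<open>a \<noteq> 0\<close>] by force
  then show False
    using p by linarith
qed

text \<open>
  The Chinese remainder theorem for natural numbers, applied to the least nonnegative representatives
  of the prescribed residues.
\<close>

lemma simultaneous_congruence:
  assumes "finite F"
  shows "\<exists>t. \<forall>n\<in>F. [t = u n] (mod modulus n)"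
proof -
  have "\<exists>t. \<forall>n\<in>F. [t = nat (u n mod modulus n)] (mod nat (modulus n))"
    by (intro chinese_remainder_nat[OF assms]) (simp add: modulus_def primes_coprime)
  then obtain t where t: "\<And>n. n \<in> F \<Longrightarrow> [t = nat (u n mod modulus n)] (mod nat (modulus n))"
    by blast
  have "[int t = u n] (mod modulus n)" if "n \<in> F" for n
  proof -
    have "int (t mod nat (modulus n)) = int (nat (u n mod modulus n) mod nat (modulus n))"
      using t[OF that] by (simp add: cong_def)
    then show ?thesis
      by (simp add: cong_def zmod_int)
  qed
  then show ?thesis
    by blast
qed

section \<open>The space of residue families\<close>

lemma topspace_residue_space:
  "x \<in> topspace residue_space \<longleftrightarrow> (\<forall>k. 0 \<le> x k \<and> x k < modulus (level k))"
  by (auto simp: residue_space_def PiE_iff)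

lemma residue_mod [simp]:
  "x \<in> topspace residue_space \<Longrightarrow> x k mod modulus (level k) = x k"
  by (simp add: topspace_residue_space)

lemma zero_in_residue_space: "(\<lambda>k. 0) \<in> topspace residue_space"
  by (simp add: topspace_residue_space)

lemma continuous_into_residue_space:
  "continuous_map Y residue_space f \<longleftrightarrow>
     (\<forall>k. continuous_map Y (discrete_topology {0..<modulus (level k)}) (\<lambda>y. f y k))"
  by (simp add: residue_space_def continuous_map_componentwise_UNIV)

lemma continuous_coordinate:
  "continuous_map residue_space (discrete_topology {0..<modulus (level k)}) (\<lambda>x. x k)"
  unfolding residue_space_def by (rule continuous_map_product_projection) simp

text \<open>
  Neighbourhoods in the product of discrete spaces: agreeing with \<open>x\<close> on finitely many coordinates
  suffices. This turns minimality and the absence of isolated points into finite problems.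
\<close>

lemma residue_space_neighbourhood:
  assumes "openin residue_space U" "x \<in> U"
  obtains F where "finite F"
    "\<And>y. y \<in> topspace residue_space \<Longrightarrow> (\<And>k. k \<in> F \<Longrightarrow> y k = x k) \<Longrightarrow> y \<in> U"
proof -
  let ?D = "\<lambda>k. discrete_topology {0..<modulus (level k)}"
  obtain V where V: "finite {k. V k \<noteq> topspace (?D k)}" "x \<in> Pi\<^sub>E UNIV V" "Pi\<^sub>E UNIV V \<subseteq> U"
    using assms unfolding residue_space_def openin_product_topology_alt
    by (auto 4 4)
  show thesis
  proof (rule that[OF V(1)])
    fix y assume y: "y \<in> topspace residue_space"
      and eq: "\<And>k. k \<in> {k. V k \<noteq> topspace (?D k)} \<Longrightarrow> y k = x k"
    have "y k \<in> V k" for k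
    proof (cases "V k = topspace (?D k)")
      case True
      then show ?thesis
        using y by (simp add: topspace_residue_space)
    next
      case False
      then show ?thesis
        using eq[of k] V(2) by (auto simp: PiE_iff)
    qed
    then show "y \<in> U"
      using V(3) by auto
  qed
qed

section \<open>The direct sum of countably many copies of the integers\<close>

lemma carrier_integer_sum: "\<gamma> \<in> carrier integer_sum \<longleftrightarrow> finite {i. \<gamma> i \<noteq> 0}"
  by (simp add: carrier_sum_group)

lemma mult_integer_sum: "\<gamma> \<otimes>\<^bsub>integer_sum\<^esub> \<delta> = (\<lambda>i. \<gamma> i + \<delta> i)"
  by (simp add: restrict_def)

lemma one_integer_sum: "\<one>\<^bsub>integer_sum\<^esub> = (\<lambda>i. 0)"
  by (simp add: restrict_def)

lemma group_integer_sum: "group integer_sum"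
  by simp

lemma countable_integer_sum: "countable (carrier integer_sum)"
proof -
  (* a finitely supported sequence is a finite list followed by zeros *)
  let ?f = "\<lambda>l::int list. \<lambda>i. if i < length l then l ! i else 0"
  have "\<gamma> \<in> range ?f" if \<gamma>: "\<gamma> \<in> carrier integer_sum" for \<gamma>
  proof -
    obtain N where N: "\<And>i. \<gamma> i \<noteq> 0 \<Longrightarrow> i < N"
      using \<gamma> unfolding carrier_integer_sum finite_nat_set_iff_bounded by blast
    have "\<gamma> = ?f (map \<gamma> [0..<N])"
      using N by (auto simp: fun_eq_iff)
    then show ?thesis
      by blast
  qed
  then show ?thesis
    by (meson countable_subset countableI_type countable_image subsetI)
qed

section \<open>The action by coordinatewise addition\<close>

lemma rotation_apply:
  "x \<in> topspace residue_space \<Longrightarrow>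
     rotation \<gamma> x = (\<lambda>k. (x k + \<gamma> (block k)) mod modulus (level k))"
  by (simp add: rotation_def)

lemma rotation_closed:
  "x \<in> topspace residue_space \<Longrightarrow> rotation \<gamma> x \<in> topspace residue_space"
  by (simp add: rotation_apply) (simp add: topspace_residue_space)

lemma rotation_add:
  assumes "x \<in> topspace residue_space"
  shows "rotation (\<lambda>i. \<gamma> i + \<delta> i) x = rotation \<gamma> (rotation \<delta> x)"
  using assms rotation_closed[OF assms, of \<delta>]
  by (simp add: rotation_apply mod_add_left_eq mod_add_right_eq add_ac)

lemma rotation_zero:
  "x \<in> topspace residue_space \<Longrightarrow> rotation (\<lambda>i. 0) x = x"
  by (simp add: rotation_apply)

text \<open>
  A single fixed point already makes every entry of \<open>\<gamma>\<close> divisible by all primes.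
\<close>

lemma rotation_free:
  assumes x: "x \<in> topspace residue_space" and fix_x: "rotation \<gamma> x = x"
  shows "\<gamma> = (\<lambda>i. 0)"
proof
  fix i
  have "modulus n dvd \<gamma> i" for n
  proof -
    let ?k = "prod_encode (i, n)"
    have "(x ?k + \<gamma> i) mod modulus n = x ?k mod modulus n"
      using fun_cong[OF fix_x, of ?k] residue_mod[OF x, of ?k]
      by (simp add: rotation_apply[OF x])
    then show ?thesis
      by (simp add: mod_eq_dvd_iff)
  qed
  then show "\<gamma> i = 0"
    by (rule eq_0_if_all_primes_dvd)
qed

text \<open>
  The finite form of density of orbits. The coordinates in \<open>F\<close> fall into finitely many copies, which
  can be treated independently; within one copy the integer required is a solution of finitely many
  congruences modulo distinct primes.
\<close>

lemma rotation_approximates: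
  assumes x: "x \<in> topspace residue_space" and y: "y \<in> topspace residue_space" and "finite F"
  obtains \<gamma> where "\<gamma> \<in> carrier integer_sum" "\<And>k. k \<in> F \<Longrightarrow> rotation \<gamma> x k = y k"
proof -
  have "\<exists>t. \<forall>n\<in>level ` F. [t = y (prod_encode (i, n)) - x (prod_encode (i, n))] (mod modulus n)" for i
    using \<open>finite F\<close> by (intro simultaneous_congruence) simp
  then obtain t where t: "\<And>i n. n \<in> level ` F \<Longrightarrow>
      [t i = y (prod_encode (i, n)) - x (prod_encode (i, n))] (mod modulus n)"
    by metis
  define \<gamma> where "\<gamma> i = (if i \<in> block ` F then t i else 0)" for i
  show thesis
  proof (rule that)
    have "{i. \<gamma> i \<noteq> 0} \<subseteq> block ` F"
      by (auto simp: \<gamma>_def)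
    then show "\<gamma> \<in> carrier integer_sum"
      using \<open>finite F\<close> finite_subset unfolding carrier_integer_sum by blast
    fix k assume "k \<in> F"
    then have "[\<gamma> (block k) = y k - x k] (mod modulus (level k))"
      using t[of "level k" "block k"] by (simp add: \<gamma>_def)
    then have "[x k + \<gamma> (block k) = x k + (y k - x k)] (mod modulus (level k))"
      by (intro cong_add) auto
    then show "rotation \<gamma> x k = y k"
      using x y by (simp add: rotation_apply cong_def)
  qed
qed

text \<open>
  Only finitely many copies are seen by a neighbourhood. Rotating any other copy by \<open>1\<close> moves the point,
  by freeness, without leaving the neighbourhood.
\<close>

lemma residue_space_no_isolated:
  assumes x: "x \<in> topspace residue_space"
  shows "\<not> openin residue_space {x}"
proof
  assume "openin residue_space {x}"
  then obtain F where F: "finite F"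
    "\<And>y. y \<in> topspace residue_space \<Longrightarrow> (\<And>k. k \<in> F \<Longrightarrow> y k = x k) \<Longrightarrow> y = x"
    using residue_space_neighbourhood[of "{x}" x] by (metis singletonD singletonI)
  obtain i where i: "i \<notin> block ` F"
    using F(1) ex_new_if_finite[of "block ` F"] by auto
  let ?\<gamma> = "\<lambda>j. if j = i then 1 else 0 :: int"
  have "rotation ?\<gamma> x = x"
    using i x by (intro F(2) rotation_closed) (auto simp: rotation_apply)
  then have "?\<gamma> = (\<lambda>j. 0)"
    by (rule rotation_free[OF x])
  then show False
    by (auto dest: fun_cong[of _ _ i])
qed

text \<open>
  Total disconnectedness is checked coordinatewise: a connected set has connected, hence trivial,
  images in the discrete factors.
\<close>

lemma Cantor_residue_space: "Cantor_space residue_space"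
  unfolding Cantor_space_def
proof (intro conjI ballI residue_space_no_isolated)
  show "topspace residue_space \<noteq> {}"
    using zero_in_residue_space by blast
  show "compact_space residue_space"
    by (simp add: residue_space_def compact_space_product_topology compact_space_discrete_topology)
  show "metrizable_space residue_space"
    by (simp add: residue_space_def metrizable_space_product_topology)
  show "totally_disconnected_space residue_space"
    unfolding totally_disconnected_space_def
  proof (intro allI impI)
    fix C assume C: "connectedin residue_space C"
    have "\<exists>a. (\<lambda>x. x k) ` C \<subseteq> {a}" for k
      using connectedin_continuous_map_image[OF continuous_coordinate C, of k]
      unfolding connectedin_discrete_topology by blast
    then obtain a where "\<And>k. (\<lambda>x. x k) ` C \<subseteq> {a k}"
      by metis
    then have "C \<subseteq> {a}"
      by (auto simp: fun_eq_iff)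
    then show "\<exists>x. C \<subseteq> {x}"
      by blast
  qed
qed

lemma rotation_Bij: "rotation \<gamma> \<in> Bij (topspace residue_space)"
proof -
  have "rotation (\<lambda>i. - \<gamma> i) (rotation \<gamma> x) = x" "rotation \<gamma> (rotation (\<lambda>i. - \<gamma> i) x) = x"
    if "x \<in> topspace residue_space" for x
    using rotation_add[OF that, of "\<lambda>i. - \<gamma> i" \<gamma>] rotation_add[OF that, of \<gamma> "\<lambda>i. - \<gamma> i"]
    by (simp_all add: rotation_zero that)
  then have "bij_betw (rotation \<gamma>) (topspace residue_space) (topspace residue_space)"
    by (intro bij_betw_byWitness[where f' = "rotation (\<lambda>i. - \<gamma> i)"]) (auto simp: rotation_closed)
  then show ?thesis
    by (simp add: Bij_def rotation_def)
qed

text \<open>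
  Coordinate \<open>k\<close> of \<open>rotation \<gamma> x\<close> depends only on \<open>\<gamma>\<close> and the single residue \<open>x k\<close>, and so factors through a
  discrete space, on which every map is continuous.
\<close>

lemma continuous_rotation_action:
  "continuous_map (prod_topology (discrete_topology A) residue_space) residue_space
     (\<lambda>(\<gamma>, x). rotation \<gamma> x)"
  unfolding continuous_into_residue_space
proof
  fix k
  let ?Z = "{0..<modulus (level k)}"
  let ?P = "prod_topology (discrete_topology A) residue_space"
  have "continuous_map ?P (prod_topology (discrete_topology A) (discrete_topology ?Z))
      (\<lambda>z. (fst z, snd z k))"
    using continuous_map_compose[OF continuous_map_snd continuous_coordinate, of "discrete_topology A" k]
    by (simp add: continuous_map_paired continuous_map_fst o_def)
  moreover have "continuous_map (prod_topology (discrete_topology A) (discrete_topology ?Z))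
      (discrete_topology ?Z) (\<lambda>(\<gamma>, a). (a + \<gamma> (block k)) mod modulus (level k))"
    by (auto simp flip: prod_topology_discrete_topology)
  ultimately have "continuous_map ?P (discrete_topology ?Z)
      ((\<lambda>(\<gamma>, a). (a + \<gamma> (block k)) mod modulus (level k)) \<circ> (\<lambda>z. (fst z, snd z k)))"
    by (rule continuous_map_compose)
  then show "continuous_map ?P (discrete_topology ?Z) (\<lambda>z. (case z of (\<gamma>, x) \<Rightarrow> rotation \<gamma> x) k)"
    by (rule continuous_map_eq) (auto simp: rotation_apply)
qed

lemma Cantor_system_rotation: "Cantor_system residue_space rotation integer_sum"
proof -
  have "rotation \<in> hom integer_sum (BijGroup (topspace residue_space))"
  proof (rule homI)
    fix \<gamma> \<delta>
    have "rotation (\<lambda>i. \<gamma> i + \<delta> i) =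
        compose (topspace residue_space) (rotation \<gamma>) (rotation \<delta>)"
    proof
      fix x
      show "rotation (\<lambda>i. \<gamma> i + \<delta> i) x =
          compose (topspace residue_space) (rotation \<gamma>) (rotation \<delta>) x"
        using rotation_add[of x \<gamma> \<delta>]
        by (cases "x \<in> topspace residue_space") (simp_all add: compose_def rotation_def)
    qed
    then show "rotation (\<gamma> \<otimes>\<^bsub>integer_sum\<^esub> \<delta>) =
        rotation \<gamma> \<otimes>\<^bsub>BijGroup (topspace residue_space)\<^esub> rotation \<delta>"
      unfolding mult_integer_sum by (simp add: BijGroup_def rotation_Bij)
  qed (simp add: BijGroup_def rotation_Bij)
  then show ?thesis
    by (intro Cantor_system.intro Cantor_system_axioms.intro group_action.intro group_hom.intro
        group_hom_axioms.intro group_integer_sum group_BijGroup Cantor_residue_space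
        countable_integer_sum continuous_rotation_action)
qed

lemma aperiodic_rotation: "aperiodic_system residue_space rotation integer_sum"
  unfolding aperiodic_system_def one_integer_sum by (intro ballI impI rotation_free)

lemma minimal_rotation: "minimal_system residue_space rotation integer_sum"
  unfolding minimal_system_def
proof (intro ballI subset_antisym subsetI)
  fix x y assume x: "x \<in> topspace residue_space" and y: "y \<in> topspace residue_space"
  show "y \<in> residue_space closure_of orbit integer_sum rotation x"
    unfolding in_closure_of
  proof (intro conjI allI impI y)
    fix U assume U: "y \<in> U \<and> openin residue_space U"
    then obtain F where F: "finite F"
      "\<And>z. z \<in> topspace residue_space \<Longrightarrow> (\<And>k. k \<in> F \<Longrightarrow> z k = y k) \<Longrightarrow> z \<in> U"
      using residue_space_neighbourhood by metis
    obtain \<gamma> where "\<gamma> \<in> carrier integer_sum" "\<And>k. k \<in> F \<Longrightarrow> rotation \<gamma> x k = y k"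
      using rotation_approximates[OF x y F(1)] by blast
    then show "\<exists>z. z \<in> orbit integer_sum rotation x \<and> z \<in> U"
      using F(2)[OF rotation_closed[OF x]] unfolding orbit_def by blast
  qed
qed (simp add: in_closure_of)

section \<open>Permuting the copies\<close>

lemma permute_blocks_apply:
  "x \<in> topspace residue_space \<Longrightarrow> permute_blocks p x = (\<lambda>k. x (relabel (inv_into UNIV p) k))"
  by (simp add: permute_blocks_def)

lemma permute_blocks_closed:
  "x \<in> topspace residue_space \<Longrightarrow> permute_blocks p x \<in> topspace residue_space"
  by (simp add: permute_blocks_apply) (metis level_relabel topspace_residue_space)

lemma permute_blocks_comp:
  assumes "bij p" "bij q" "x \<in> topspace residue_space"
  shows "permute_blocks (p \<circ> q) x = permute_blocks p (permute_blocks q x)"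
  using assms permute_blocks_closed[OF assms(3), of q]
  by (simp add: permute_blocks_apply relabel_comp o_inv_distrib)

lemma permute_blocks_id: "x \<in> topspace residue_space \<Longrightarrow> permute_blocks id x = x"
  by (simp add: permute_blocks_apply)

lemma permute_blocks_inverse:
  assumes "bij p" "x \<in> topspace residue_space"
  shows "permute_blocks (inv_into UNIV p) (permute_blocks p x) = x"
    and "permute_blocks p (permute_blocks (inv_into UNIV p) x) = x"
proof -
  have "inv_into UNIV p \<circ> p = id" "p \<circ> inv_into UNIV p = id"
    using assms(1) by (simp_all add: bij_is_inj bij_is_surj flip: surj_iff)
  then show "permute_blocks (inv_into UNIV p) (permute_blocks p x) = x"
    and "permute_blocks p (permute_blocks (inv_into UNIV p) x) = x"
    using permute_blocks_comp[OF bij_imp_bij_inv[OF assms(1)] assms]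
      permute_blocks_comp[OF assms(1) bij_imp_bij_inv[OF assms(1)] assms(2)]
    by (simp_all add: permute_blocks_id assms(2))
qed

lemma continuous_permute_blocks: "continuous_map residue_space residue_space (permute_blocks p)"
proof -
  have "continuous_map residue_space (discrete_topology {0..<modulus (level k)})
      (\<lambda>x. x (relabel (inv_into UNIV p) k))" for k
    using continuous_coordinate[of "relabel (inv_into UNIV p) k"] by simp
  then have "continuous_map residue_space residue_space (\<lambda>x k. x (relabel (inv_into UNIV p) k))"
    by (simp add: continuous_into_residue_space)
  then show ?thesis
    by (rule continuous_map_eq) (simp add: permute_blocks_apply)
qed

lemma permute_blocks_homeo:
  assumes "bij p"
  shows "permute_blocks p \<in> carrier (homeo_group residue_space)"
proof -
  have "homeomorphic_maps residue_space residue_space (permute_blocks p) (permute_blocks (inv_into UNIV p))"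
    by (simp add: homeomorphic_maps_def continuous_permute_blocks permute_blocks_inverse assms)
  then have h: "homeomorphic_map residue_space residue_space (permute_blocks p)"
    using homeomorphic_map_maps by blast
  then have "bij_betw (permute_blocks p) (topspace residue_space) (topspace residue_space)"
    by (simp add: bij_betw_def homeomorphic_imp_injective_map homeomorphic_imp_surjective_map)
  then show ?thesis
    using h by (simp add: homeo_group_def Bij_def permute_blocks_def)
qed

lemma homeo_group_mult:
  assumes "f \<in> carrier (homeo_group X)" "g \<in> carrier (homeo_group X)"
  shows "f \<otimes>\<^bsub>homeo_group X\<^esub> g = compose (topspace X) f g"
  using assms by (simp add: homeo_group_def BijGroup_def)

text \<open>
  The commutation relation behind the theorem: rotating copy \<open>i\<close> by \<open>\<gamma> i\<close> and moving it to place \<open>j = p i\<close>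
  is the same as moving it first and then rotating copy \<open>j\<close> by \<open>\<gamma> (p\<^sup>-\<^sup>1 j)\<close>.
\<close>

lemma permute_blocks_rotation:
  assumes "x \<in> topspace residue_space"
  shows "permute_blocks p (rotation \<gamma> x) = rotation (\<gamma> \<circ> inv_into UNIV p) (permute_blocks p x)"
  using assms permute_blocks_closed[OF assms, of p] rotation_closed[OF assms, of \<gamma>]
  by (simp add: permute_blocks_apply rotation_apply)

lemma integer_sum_permute:
  assumes "bij p" "\<gamma> \<in> carrier integer_sum"
  shows "\<gamma> \<circ> p \<in> carrier integer_sum"
proof -
  have "{i. (\<gamma> \<circ> p) i \<noteq> 0} = p -` {i. \<gamma> i \<noteq> 0}"
    by auto
  then show ?thesis
    using assms finite_vimageI[OF _ bij_is_inj] unfolding carrier_integer_sum by metis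
qed

text \<open>
  Both inclusions of \<open>g H g\<^sup>-\<^sup>1 = H\<close>, with the inverses cleared, so that it is enough to compare
  products such as \<open>g h\<close> and \<open>h' g\<close>.
\<close>

lemma normalizer_memI:
  assumes "group G" and g: "g \<in> carrier G" and H: "H \<subseteq> carrier G"
    and right: "\<And>h. h \<in> H \<Longrightarrow> \<exists>h'\<in>H. g \<otimes>\<^bsub>G\<^esub> h = h' \<otimes>\<^bsub>G\<^esub> g"
    and left: "\<And>h'. h' \<in> H \<Longrightarrow> \<exists>h\<in>H. g \<otimes>\<^bsub>G\<^esub> h = h' \<otimes>\<^bsub>G\<^esub> g"
  shows "g \<in> normalizer G H"
proof -
  interpret group G by fact
  have cancel: "h' \<otimes>\<^bsub>G\<^esub> g \<otimes>\<^bsub>G\<^esub> inv\<^bsub>G\<^esub> g = h'" if "h' \<in> H" for h'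
    using that g H by (auto simp: m_assoc)
  have "g <#\<^bsub>G\<^esub> H #>\<^bsub>G\<^esub> inv\<^bsub>G\<^esub> g = (\<lambda>h. g \<otimes>\<^bsub>G\<^esub> h \<otimes>\<^bsub>G\<^esub> inv\<^bsub>G\<^esub> g) ` H"
    by (auto simp: l_coset_def r_coset_def)
  also have "\<dots> = H"
  proof (intro subset_antisym subsetI)
    fix a assume "a \<in> (\<lambda>h. g \<otimes>\<^bsub>G\<^esub> h \<otimes>\<^bsub>G\<^esub> inv\<^bsub>G\<^esub> g) ` H"
    then obtain h where "h \<in> H" "a = g \<otimes>\<^bsub>G\<^esub> h \<otimes>\<^bsub>G\<^esub> inv\<^bsub>G\<^esub> g"
      by blast
    then show "a \<in> H"
      using right[of h] cancel by metis
  next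
    fix a assume "a \<in> H"
    then obtain h where "h \<in> H" "g \<otimes>\<^bsub>G\<^esub> h = a \<otimes>\<^bsub>G\<^esub> g"
      using left by blast
    then show "a \<in> (\<lambda>h. g \<otimes>\<^bsub>G\<^esub> h \<otimes>\<^bsub>G\<^esub> inv\<^bsub>G\<^esub> g) ` H"
      using cancel[OF \<open>a \<in> H\<close>] by (metis image_eqI)
  qed
  finally show ?thesis
    using g H by (simp add: normalizer_def stabilizer_def)
qed

lemma permute_blocks_normalizes:
  assumes "bij p"
  shows "permute_blocks p \<in> carrier (Norm residue_space rotation integer_sum)"
proof -
  interpret R: Cantor_system residue_space rotation integer_sum
    by (rule Cantor_system_rotation)
  let ?H = "homeo_group residue_space"
  have rot: "rotation \<gamma> \<in> carrier ?H" if "\<gamma> \<in> carrier integer_sum" for \<gamma>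
    using R.acts_by_homeomorphisms that by blast
  have comm: "permute_blocks p \<otimes>\<^bsub>?H\<^esub> rotation \<gamma> = rotation (\<gamma> \<circ> inv_into UNIV p) \<otimes>\<^bsub>?H\<^esub> permute_blocks p"
    if "\<gamma> \<in> carrier integer_sum" for \<gamma>
    using that assms
    by (simp add: homeo_group_mult permute_blocks_homeo rot integer_sum_permute bij_imp_bij_inv
        compose_def permute_blocks_rotation cong: restrict_cong del: o_apply)
  have "permute_blocks p \<in> normalizer ?H (rotation ` carrier integer_sum)"
  proof (rule normalizer_memI[OF group_homeo_group permute_blocks_homeo[OF assms]
        R.acts_by_homeomorphisms])
    fix h assume "h \<in> rotation ` carrier integer_sum"
    then obtain \<gamma> where \<gamma>: "\<gamma> \<in> carrier integer_sum" "h = rotation \<gamma>"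
      by blast
    then show "\<exists>h'\<in>rotation ` carrier integer_sum.
        permute_blocks p \<otimes>\<^bsub>?H\<^esub> h = h' \<otimes>\<^bsub>?H\<^esub> permute_blocks p"
      using comm integer_sum_permute[OF bij_imp_bij_inv[OF assms]] by blast
    have cancel: "\<gamma> \<circ> p \<circ> inv_into UNIV p = \<gamma>"
      using assms by (simp add: comp_assoc surj_iff[THEN iffD1] bij_is_surj)
    show "\<exists>h'\<in>rotation ` carrier integer_sum.
        permute_blocks p \<otimes>\<^bsub>?H\<^esub> h' = h \<otimes>\<^bsub>?H\<^esub> permute_blocks p"
    proof (rule bexI)
      show "rotation (\<gamma> \<circ> p) \<in> rotation ` carrier integer_sum"
        by (rule imageI[OF integer_sum_permute[OF assms \<gamma>(1)]])
      show "permute_blocks p \<otimes>\<^bsub>?H\<^esub> rotation (\<gamma> \<circ> p) = h \<otimes>\<^bsub>?H\<^esub> permute_blocks p"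
        using comm[OF integer_sum_permute[OF assms \<gamma>(1)]] cancel
        by (simp only: \<gamma>(2))
    qed
  qed
  then show ?thesis
    by (simp add: Norm_def)
qed

section \<open>Countable groups inside the symmetric group of the naturals\<close>

lemma carrier_BijGroup_UNIV: "p \<in> carrier (BijGroup UNIV) \<longleftrightarrow> bij p"
  by (simp add: BijGroup_def Bij_def)

lemma mult_BijGroup_UNIV: "bij p \<Longrightarrow> bij q \<Longrightarrow> p \<otimes>\<^bsub>BijGroup UNIV\<^esub> q = p \<circ> q"
  by (auto simp: BijGroup_def Bij_def compose_def)

lemma permute_blocks_hom:
  "permute_blocks \<in> hom (BijGroup UNIV) (Norm residue_space rotation integer_sum)"
proof (rule homI)
  fix p :: "nat \<Rightarrow> nat" assume "p \<in> carrier (BijGroup UNIV)"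
  then show "permute_blocks p \<in> carrier (Norm residue_space rotation integer_sum)"
    by (simp add: carrier_BijGroup_UNIV permute_blocks_normalizes)
next
  fix p q :: "nat \<Rightarrow> nat" assume "p \<in> carrier (BijGroup UNIV)" "q \<in> carrier (BijGroup UNIV)"
  then have "bij p" "bij q"
    by (simp_all add: carrier_BijGroup_UNIV)
  moreover have "compose (topspace residue_space) (permute_blocks p) (permute_blocks q) =
      permute_blocks (p \<circ> q)"
  proof
    fix x
    show "compose (topspace residue_space) (permute_blocks p) (permute_blocks q) x =
        permute_blocks (p \<circ> q) x"
      using permute_blocks_comp[OF \<open>bij p\<close> \<open>bij q\<close>, of x]
      by (cases "x \<in> topspace residue_space") (simp_all add: compose_def permute_blocks_def)
  qed
  ultimately show "permute_blocks (p \<otimes>\<^bsub>BijGroup UNIV\<^esub> q) =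
      permute_blocks p \<otimes>\<^bsub>Norm residue_space rotation integer_sum\<^esub> permute_blocks q"
    by (simp add: mult_BijGroup_UNIV Norm_def homeo_group_mult permute_blocks_homeo)
qed

lemma permute_blocks_inj: "inj_on permute_blocks (carrier (BijGroup UNIV))"
proof (rule inj_onI)
  fix p q :: "nat \<Rightarrow> nat"
  assume "p \<in> carrier (BijGroup UNIV)" "q \<in> carrier (BijGroup UNIV)"
    and eq: "permute_blocks p = permute_blocks q"
  then have pq: "bij p" "bij q"
    by (simp_all add: carrier_BijGroup_UNIV)
  have "inv_into UNIV p i = inv_into UNIV q i" for i
  proof -
    (* a point whose only nonzero residue is modulo 2, in the copy that p sends to place i *)
    let ?x = "\<lambda>k. if k = prod_encode (inv_into UNIV p i, 2) then 1 else 0 :: int"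
    have x: "?x \<in> topspace residue_space"
      by (auto simp: topspace_residue_space modulus_def prime_gt_0_nat)
    have "permute_blocks p ?x (prod_encode (i, 2)) = permute_blocks q ?x (prod_encode (i, 2))"
      using eq by simp
    then show ?thesis
      by (simp add: permute_blocks_apply[OF x] relabel_def split: if_splits)
  qed
  then have "inv_into UNIV p = inv_into UNIV q"
    by blast
  then show "p = q"
    using pq by (metis inv_inv_eq)
qed

text \<open>
  Cayley's theorem: the left regular representation, transported to \<open>\<nat>\<close> along an injection \<open>f\<close> of the
  carrier. Off the image of \<open>f\<close>, which may be a proper subset of \<open>\<nat>\<close>, each permutation is the identity.
\<close>

lemma countable_group_embeds_in_permutations:
  fixes G :: "('g, 'm) monoid_scheme"
  assumes "group G" and "countable (carrier G)"
  obtains \<phi> :: "'g \<Rightarrow> nat \<Rightarrow> nat"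
  where "\<phi> \<in> hom G (BijGroup UNIV)" "inj_on \<phi> (carrier G)"
proof -
  interpret group G by fact
  obtain f :: "'g \<Rightarrow> nat" where f: "inj_on f (carrier G)"
    using assms(2) by (auto simp: countable_def)
  define \<phi> where "\<phi> g k = (if k \<in> f ` carrier G
    then f (g \<otimes>\<^bsub>G\<^esub> inv_into (carrier G) f k) else k)" for g k
  have \<phi>_in: "\<phi> g (f a) = f (g \<otimes>\<^bsub>G\<^esub> a)" if "a \<in> carrier G" for g a
    using that f by (simp add: \<phi>_def)
  have \<phi>_out: "\<phi> g k = k" if "k \<notin> f ` carrier G" for g k
    using that by (simp add: \<phi>_def)
  have mult: "\<phi> (g \<otimes>\<^bsub>G\<^esub> h) = \<phi> g \<circ> \<phi> h" if "g \<in> carrier G" "h \<in> carrier G" for g h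
  proof
    fix k
    show "\<phi> (g \<otimes>\<^bsub>G\<^esub> h) k = (\<phi> g \<circ> \<phi> h) k"
      using that by (cases "k \<in> f ` carrier G") (auto simp: \<phi>_in \<phi>_out m_assoc)
  qed
  have one: "\<phi> \<one>\<^bsub>G\<^esub> = id"
  proof
    fix k
    show "\<phi> \<one>\<^bsub>G\<^esub> k = id k"
      by (cases "k \<in> f ` carrier G") (auto simp: \<phi>_in \<phi>_out)
  qed
  have bij: "bij (\<phi> g)" if "g \<in> carrier G" for g
    using mult[OF that inv_closed[OF that]] mult[OF inv_closed[OF that] that] that
    by (intro o_bij[of "\<phi> (inv\<^bsub>G\<^esub> g)"]) (simp_all add: one)
  show thesis
  proof (rule that)
    show "\<phi> \<in> hom G (BijGroup UNIV)"
      by (rule homI) (simp_all add: carrier_BijGroup_UNIV bij mult mult_BijGroup_UNIV)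
    show "inj_on \<phi> (carrier G)"
    proof (rule inj_onI)
      fix g h assume gh: "g \<in> carrier G" "h \<in> carrier G" "\<phi> g = \<phi> h"
      then have "f g = f h"
        using \<phi>_in[OF one_closed, of g] \<phi>_in[OF one_closed, of h] by simp
      then show "g = h"
        using f gh by (simp add: inj_on_def)
    qed
  qed
qed

lemma iso_image_subgroup:
  assumes "group G" "group K" "\<psi> \<in> hom G K" "inj_on \<psi> (carrier G)"
  shows "\<exists>L. subgroup L K \<and> G \<cong> K\<lparr>carrier := L\<rparr>"
proof (intro exI conjI)
  interpret group_hom G K \<psi>
    using assms by (simp add: group_hom_def group_hom_axioms_def)
  show "subgroup (\<psi> ` carrier G) K"
    by (rule img_is_subgroup)
  have "\<psi> \<in> iso G (K\<lparr>carrier := \<psi> ` carrier G\<rparr>)"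
    using assms(3,4) by (auto simp: Group.iso_def bij_betw_def hom_def)
  then show "G \<cong> K\<lparr>carrier := \<psi> ` carrier G\<rparr>"
    by (rule is_isoI)
qed

section \<open>Realizing a countable group in a normalizer\<close>

theorem proposition4:
  fixes G :: "('g, 'm) monoid_scheme"
  assumes "group G" and "countable (carrier G)"
  shows "\<exists>(\<Gamma> :: (nat \<Rightarrow> int) monoid) (X :: (nat \<Rightarrow> int) topology) S.
           group \<Gamma> \<and> countable (carrier \<Gamma>) \<and>
           (\<exists>H. subgroup H (sum_group (UNIV :: nat set) (\<lambda>_. integer_group)) \<and>
                \<Gamma> \<cong> (sum_group (UNIV :: nat set) (\<lambda>_. integer_group)) \<lparr>carrier := H\<rparr>) \<and>
           (\<exists>B :: nat set. \<Gamma> \<cong> free_Abelian_group B) \<and>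
           Cantor_system X S \<Gamma> \<and> aperiodic_system X S \<Gamma> \<and> minimal_system X S \<Gamma> \<and>
           (\<exists>K. subgroup K (Norm X S \<Gamma>) \<and> G \<cong> (Norm X S \<Gamma>) \<lparr>carrier := K\<rparr>)"
proof (intro exI[of _ integer_sum] exI[of _ residue_space] exI[of _ rotation] conjI)
  let ?N = "Norm residue_space rotation integer_sum"
  show "group integer_sum" "countable (carrier integer_sum)"
    by (rule group_integer_sum, rule countable_integer_sum)
  show "\<exists>H. subgroup H integer_sum \<and> integer_sum \<cong> integer_sum\<lparr>carrier := H\<rparr>"
    using group.subgroup_self[OF group_integer_sum]
    by (intro exI[of _ "carrier integer_sum"]) simp
  show "\<exists>B :: nat set. integer_sum \<cong> free_Abelian_group B"
    using isomorphic_sum_integer_group by blast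
  show "Cantor_system residue_space rotation integer_sum"
    "aperiodic_system residue_space rotation integer_sum"
    "minimal_system residue_space rotation integer_sum"
    by (rule Cantor_system_rotation aperiodic_rotation minimal_rotation)+
  obtain \<phi> :: "'g \<Rightarrow> nat \<Rightarrow> nat"
    where \<phi>: "\<phi> \<in> hom G (BijGroup UNIV)" "inj_on \<phi> (carrier G)"
    using countable_group_embeds_in_permutations[OF assms] by blast
  show "\<exists>K. subgroup K ?N \<and> G \<cong> ?N\<lparr>carrier := K\<rparr>"
  proof (rule iso_image_subgroup[OF \<open>group G\<close> Cantor_system.group_Norm[OF Cantor_system_rotation]])
    show "permute_blocks \<circ> \<phi> \<in> hom G ?N"
      by (rule hom_compose[OF \<phi>(1) permute_blocks_hom])
    have "\<phi> ` carrier G \<subseteq> carrier (BijGroup UNIV)"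
      using \<phi>(1) by (auto simp: hom_def)
    then show "inj_on (permute_blocks \<circ> \<phi>) (carrier G)"
      using \<phi>(2) permute_blocks_inj inj_on_subset by (blast intro: comp_inj_on)
  qed
qed

end
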